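(* Let $X,Y$ be two weakly locally convex topological cones, and let $\alpha\colon\mathcal V_{\mathrm f}X\to X$ and $\beta\colon\mathcal V_{\mathrm f}Y\to Y$ be the corresponding barycentre maps $\sum_{i=1}^nr_i\delta_{x_i}\mapsto\sum_{i=1}^nr_ix_i$. Then a continuous map $f\colon X\to Y$ is a $\mathcal V_{\mathrm f}$-algebra morphism (from $(X,\alpha)$ to $(Y,\beta)$) if and only if $f$ is linear.
   Context: $\mathbb R_+=[0,\infty)$ and $\overline{\mathbb R}_+=[0,\infty]$, both with the Scott topology (proper nonempty opens are the sets of elements $>r$, $r\in\mathbb R_+$). Valuations. For a space $X$ with lattice of opens $\mathcal OX$ and $x\in X$, the Dirac mass $\delta_x\colon\mathcal OX\to\overline{\mathbb R}_+$ is $\delta_x(U)=1$ if $x\in U$, and $0$ otherwise. A simple valuation on $X$ is a finite linear combination $\sum_{i=1}^nr_i\delta_{x_i}$ ($r_i\in\mathbb R_+$, $x_i\in X$), computed pointwise. $\mathcal V_{\mathrm f}X$ is the set of simple valuations on $X$ with the (weak) topology generated by the subbasic sets $\{\mu\mid\mu(U)>r\}$, $U\in\mathcal OX$, $r\in\mathbb R_+$. For continuous $f\colon X\to Y$, $\mathcal V_{\mathrm f}f(\mu)(V)=\mu(f^{-1}(V))$, i.e. $\mathcal V_{\mathrm f}f(\sum r_i\delta_{x_i})=\sum r_i\delta_{f(x_i)}$. On a weakly locally convex topological cone $X$, the map $\sum_{i=1}^nr_i\delta_{x_i}\mapsto\sum_{i=1}^nr_ix_i$ is well-defined, continuous, linear,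 and is the structure map of an Eilenberg–Moore algebra for the monad $\mathcal V_{\mathrm f}$ on $T_0$ spaces (unit $x\mapsto\delta_x$, multiplication $\varpi\mapsto(U\mapsto\int\mu(U)\,d\varpi)$). A $\mathcal V_{\mathrm f}$-algebra morphism from $(X,\alpha)$ to $(Y,\beta)$ is a continuous map $f\colon X\to Y$ with $\beta\circ\mathcal V_{\mathrm f}f=f\circ\alpha$. Cones. A cone is a commutative monoid $(C,+,0)$ with a scalar multiplication $\mathbb R_+\times C\to C$ such that $r(x+y)=rx+ry$, $(r+s)x=rx+sx$, $(rs)x=r(sx)$, $1x=x$, $0x=0$, $r0=0$. A topological cone is a cone with a $T_0$ topology making $+$ and scalar multiplication jointly continuous. A map $f$ between cones is linear if $f(rx+sy)=rf(x)+sf(y)$ for all $r,s\in\mathbb R_+$. A subset $A$ of a cone is convex if $ra+(1-r)b\in A$ for all $a,b\in A$, $r\in[0,1]$. A cone with a $T_0$ topology is weakly locally convex if for every point $x$, every open neighbourhood of $x$ contains a convex (not necessarily open) neighbourhood of $x$. *)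

theory Defs
  imports "HOL-Analysis.Analysis" "HOL-Algebra.Module"
begin

section \<open>The Scott topology on the nonnegative reals\<close>

definition scott_nonneg :: "real topology" where
  "scott_nonneg = topology (\<lambda>U. U = {} \<or> U = {0..} \<or> (\<exists>r\<ge>0. U = {r<..}))"

lemma openin_scott_nonneg:
  "openin scott_nonneg U \<longleftrightarrow> U = {} \<or> U = {0..} \<or> (\<exists>r\<ge>0. U = {r<..})"
proof -
  let ?L = "\<lambda>U::real set. U = {} \<or> U = {0..} \<or> (\<exists>r\<ge>0. U = {r<..})"
  have up: "?L U \<longleftrightarrow> U \<subseteq> {0..} \<and> (\<forall>x\<in>U. \<forall>y\<ge>x. y \<in> U) \<and> (\<forall>x\<in>U. x > 0 \<longrightarrow> (\<exists>y\<in>U. y < x))"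
    for U :: "real set"
  proof
    assume "?L U"
    then consider "U = {}" | "U = {0..}" | r where "r \<ge> 0" "U = {r<..}" by blast
    then show "U \<subseteq> {0..} \<and> (\<forall>x\<in>U. \<forall>y\<ge>x. y \<in> U) \<and> (\<forall>x\<in>U. x > 0 \<longrightarrow> (\<exists>y\<in>U. y < x))"
    proof cases
      case 3
      have "\<exists>y\<in>U. y < x" if "x \<in> U" for x
        using that 3 dense[of r x] by auto
      then show ?thesis using 3 by auto
    qed auto
  next
    assume A: "U \<subseteq> {0..} \<and> (\<forall>x\<in>U. \<forall>y\<ge>x. y \<in> U) \<and> (\<forall>x\<in>U. x > 0 \<longrightarrow> (\<exists>y\<in>U. y < x))"
    show "?L U"
    proof (cases "U = {} \<or> 0 \<in> U")
      case True
      then show ?thesis using A by auto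
    next
      case False
      have bdd: "bdd_below U" using A by (meson bdd_below.I atLeast_iff subsetD)
      define r where "r = Inf U"
      have "r \<ge> 0" using False A unfolding r_def by (intro cInf_greatest) auto
      moreover have "U = {r<..}"
      proof (intro equalityI subsetI)
        fix x assume x: "x \<in> U"
        then have "x \<ge> 0" "x \<noteq> 0" using A False by auto
        then have "x > 0" by simp
        then obtain y where "y \<in> U" "y < x" using A x by blast
        then show "x \<in> {r<..}" using cInf_lower[OF _ bdd, of y] r_def by auto
      next
        fix x assume "x \<in> {r<..}"
        then obtain y where "y \<in> U" "y < x"
          using False bdd cInf_less_iff[of U x] unfolding r_def by auto
        then show "x \<in> U" using A by auto
      qed
      ultimately show ?thesis by blast
    qed
  qed
  have "istopology ?L"
    unfolding istopology_def
  proof (intro conjI allI impI)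
    fix S T :: "real set"
    assume S: "?L S" and T: "?L T"
    show "?L (S \<inter> T)"
      unfolding up
    proof (intro conjI ballI impI allI)
      show "S \<inter> T \<subseteq> {0..}" using S unfolding up by blast
    next
      fix x y :: real assume "x \<in> S \<inter> T" "x \<le> y"
      then show "y \<in> S \<inter> T" using S T unfolding up by blast
    next
      fix x :: real assume x: "x \<in> S \<inter> T" "0 < x"
      have up_S: "\<forall>u\<in>S. \<forall>v\<ge>u. v \<in> S" and low_S: "\<forall>u\<in>S. u > 0 \<longrightarrow> (\<exists>v\<in>S. v < u)"
        using S[unfolded up] by simp_all
      have up_T: "\<forall>u\<in>T. \<forall>v\<ge>u. v \<in> T" and low_T: "\<forall>u\<in>T. u > 0 \<longrightarrow> (\<exists>v\<in>T. v < u)"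
        using T[unfolded up] by simp_all
      obtain y where y: "y \<in> S" "y < x" using low_S x by auto
      obtain z where z: "z \<in> T" "z < x" using low_T x by auto
      have "max y z \<in> S" using up_S y(1) by (meson max.cobounded1)
      moreover have "max y z \<in> T" using up_T z(1) by (meson max.cobounded2)
      ultimately show "\<exists>y\<in>S \<inter> T. y < x"
        using y(2) z(2) by (intro bexI[of _ "max y z"]) auto
    qed
  next
    fix K :: "real set set"
    assume K: "\<forall>U\<in>K. ?L U"
    have sub: "U \<subseteq> {0..}" and up_U: "\<And>x y. x \<in> U \<Longrightarrow> x \<le> y \<Longrightarrow> y \<in> U"
      and low: "\<And>x. x \<in> U \<Longrightarrow> x > 0 \<Longrightarrow> \<exists>y\<in>U. y < x" if "U \<in> K" for U
      using K[unfolded up, rule_format, OF that] by simp_all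
    show "?L (\<Union>K)"
      unfolding up
    proof (intro conjI ballI impI allI)
      show "\<Union>K \<subseteq> {0..}" using sub by (rule Union_least)
    next
      fix x y :: real assume "x \<in> \<Union>K" "x \<le> y"
      then show "y \<in> \<Union>K" using up_U by (meson Union_iff)
    next
      fix x :: real assume "x \<in> \<Union>K" "0 < x"
      then show "\<exists>y\<in>\<Union>K. y < x" using low by (meson Union_iff)
    qed
  qed
  then show ?thesis
    unfolding scott_nonneg_def by simp
qed

section \<open>Cones\<close>

text \<open>A cone is rendered on the record type of HOL-Algebra modules. As for modules there,
  the multiplicative fields of the record are irrelevant. The scalar multiplication is only
  constrained on nonnegative reals.\<close>

locale cone = abelian_monoid C for C :: "(real, 'a, 'm) module_scheme" (structure) +
  assumes smult_closed: "\<lbrakk>0 \<le> r; x \<in> carrier C\<rbrakk> \<Longrightarrow> r \<odot> x \<in> carrier C"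
    and smult_add_right:
      "\<lbrakk>0 \<le> r; x \<in> carrier C; y \<in> carrier C\<rbrakk> \<Longrightarrow> r \<odot> (x \<oplus> y) = r \<odot> x \<oplus> r \<odot> y"
    and smult_add_left:
      "\<lbrakk>0 \<le> r; 0 \<le> s; x \<in> carrier C\<rbrakk> \<Longrightarrow> (r + s) \<odot> x = r \<odot> x \<oplus> s \<odot> x"
    and smult_assoc:
      "\<lbrakk>0 \<le> r; 0 \<le> s; x \<in> carrier C\<rbrakk> \<Longrightarrow> (r * s) \<odot> x = r \<odot> (s \<odot> x)"
    and smult_one: "x \<in> carrier C \<Longrightarrow> 1 \<odot> x = x"
    and smult_zero_left: "x \<in> carrier C \<Longrightarrow> 0 \<odot> x = \<zero>"
    and smult_zero_right: "0 \<le> r \<Longrightarrow> r \<odot> \<zero> = \<zero>"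

locale cone_with_t0_topology = cone C for C :: "(real, 'a, 'm) module_scheme" (structure) +
  fixes T :: "'a topology"
  assumes topspace_eq: "topspace T = carrier C"
    and t0: "t0_space T"

locale topological_cone = cone_with_t0_topology +
  assumes continuous_add:
      "continuous_map (prod_topology T T) T (\<lambda>(x, y). x \<oplus> y)"
    and continuous_smult:
      "continuous_map (prod_topology scott_nonneg T) T (\<lambda>(r, x). r \<odot> x)"

definition cone_convex :: "(real, 'a, 'm) module_scheme \<Rightarrow> 'a set \<Rightarrow> bool" where
  "cone_convex C A \<longleftrightarrow> A \<subseteq> carrier C \<and>
     (\<forall>a\<in>A. \<forall>b\<in>A. \<forall>r\<in>{0..1}. r \<odot>\<^bsub>C\<^esub> a \<oplus>\<^bsub>C\<^esub> (1 - r) \<odot>\<^bsub>C\<^esub> b \<in> A)"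

locale weakly_locally_convex_cone = cone_with_t0_topology +
  assumes weakly_locally_convex:
    "\<lbrakk>openin T U; x \<in> U\<rbrakk> \<Longrightarrow>
       \<exists>A. cone_convex C A \<and> A \<subseteq> U \<and> (\<exists>W. openin T W \<and> x \<in> W \<and> W \<subseteq> A)"

locale weakly_locally_convex_topological_cone =
  topological_cone + weakly_locally_convex_cone

definition cone_linear ::
    "(real, 'a, 'm) module_scheme \<Rightarrow> (real, 'b, 'n) module_scheme \<Rightarrow> ('a \<Rightarrow> 'b) \<Rightarrow> bool" where
  "cone_linear C D f \<longleftrightarrow>
     (\<forall>r\<ge>0. \<forall>s\<ge>0. \<forall>x\<in>carrier C. \<forall>y\<in>carrier C.
        f (r \<odot>\<^bsub>C\<^esub> x \<oplus>\<^bsub>C\<^esub> s \<odot>\<^bsub>C\<^esub> y) = r \<odot>\<^bsub>D\<^esub> f x \<oplus>\<^bsub>D\<^esub> s \<odot>\<^bsub>D\<^esub> f y)"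

section \<open>Simple valuations\<close>

text \<open>Valuations are functions on the open sets of a space, made extensional
  (\<open>undefined\<close> on sets that are not open) so that equality of valuations is equality
  of functions.\<close>

definition dirac :: "'a topology \<Rightarrow> 'a \<Rightarrow> 'a set \<Rightarrow> ennreal" where
  "dirac X x = (\<lambda>U\<in>{U. openin X U}. if x \<in> U then 1 else 0)"

definition dirac_comb ::
    "'a topology \<Rightarrow> nat \<Rightarrow> (nat \<Rightarrow> real) \<Rightarrow> (nat \<Rightarrow> 'a) \<Rightarrow> 'a set \<Rightarrow> ennreal" where
  "dirac_comb X n r x = (\<lambda>U\<in>{U. openin X U}. \<Sum>i<n. ennreal (r i) * dirac X (x i) U)"

definition simple_valuations :: "'a topology \<Rightarrow> ('a set \<Rightarrow> ennreal) set" where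
  "simple_valuations X =
     {dirac_comb X n r x | n r x. \<forall>i<n. 0 \<le> r i \<and> x i \<in> topspace X}"

text \<open>The whole set is added to the subbasis because the zero valuation lies in no
  subbasic open set.\<close>

definition Vf :: "'a topology \<Rightarrow> ('a set \<Rightarrow> ennreal) topology" where
  "Vf X = topology_generated_by
     (insert (simple_valuations X)
        {{\<mu> \<in> simple_valuations X. ennreal r < \<mu> U} | U r. openin X U \<and> 0 \<le> r})"

lemma topspace_Vf: "topspace (Vf X) = simple_valuations X"
  unfolding Vf_def topology_generated_by_topspace by blast

definition Vf_map ::
    "'a topology \<Rightarrow> 'b topology \<Rightarrow> ('a \<Rightarrow> 'b) \<Rightarrow> ('a set \<Rightarrow> ennreal) \<Rightarrow> 'b set \<Rightarrow> ennreal" where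
  "Vf_map X Y f \<mu> = (\<lambda>V\<in>{V. openin Y V}. \<mu> {x \<in> topspace X. f x \<in> V})"

definition Vf_algebra_morphism ::
    "'a topology \<Rightarrow> (('a set \<Rightarrow> ennreal) \<Rightarrow> 'a) \<Rightarrow>
     'b topology \<Rightarrow> (('b set \<Rightarrow> ennreal) \<Rightarrow> 'b) \<Rightarrow> ('a \<Rightarrow> 'b) \<Rightarrow> bool" where
  "Vf_algebra_morphism X \<alpha> Y \<beta> f \<longleftrightarrow>
     continuous_map X Y f \<and> (\<forall>\<mu>\<in>topspace (Vf X). \<beta> (Vf_map X Y f \<mu>) = f (\<alpha> \<mu>))"

text \<open>The description is proper on simple valuations over a cone with a \<open>T\<^sub>0\<close> topology:
  there \<open>\<mu>\<close> determines the total coefficient of each point, hence the value of the sum.\<close>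

definition barycentre ::
    "(real, 'a, 'm) module_scheme \<Rightarrow> 'a topology \<Rightarrow> ('a set \<Rightarrow> ennreal) \<Rightarrow> 'a" where
  "barycentre C T \<mu> =
     (THE y. \<exists>n r x. (\<forall>i<n. 0 \<le> r i \<and> x i \<in> carrier C) \<and> \<mu> = dirac_comb T n r x \<and>
        y = (\<Oplus>\<^bsub>C\<^esub>i\<in>{..<n}. r i \<odot>\<^bsub>C\<^esub> x i))"

end

theory Submission
  imports Defs
begin

text \<open>On a \<open>T\<^sub>0\<close> space every nonempty finite set has a relatively open point, so a simple
  valuation determines the total coefficient of each point, and the barycentre map really sends
  a combination of Dirac masses to the corresponding combination of points. Hence an algebra
  morphism is a continuous map that preserves finite combinations with nonnegative
  coefficients; linearity is the case of two summands, and it gives the general case by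
  induction on the number of summands.\<close>

text \<open>An open set meeting \<open>D\<close> in as few points as possible works: two points left
  in its trace on \<open>D\<close> could be separated by a further open set, and intersecting with
  that one would give a smaller nonempty trace.\<close>

lemma t0_space_finite_open_point:
  assumes "t0_space X" "finite D" "D \<noteq> {}" "D \<subseteq> topspace X"
  obtains U p where "openin X U" "U \<inter> D = {p}"
proof -
  define \<U> where "\<U> = {U. openin X U \<and> U \<inter> D \<noteq> {}}"
  have "topspace X \<in> \<U>"
    using assms by (auto simp: \<U>_def)
  then obtain U where U: "U \<in> \<U>" and min: "\<And>V. V \<in> \<U> \<Longrightarrow> card (U \<inter> D) \<le> card (V \<inter> D)"
    using ex_has_least_nat[of "\<lambda>U. U \<in> \<U>" "topspace X" "\<lambda>U. card (U \<inter> D)"] by blast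
  obtain p where p: "p \<in> U \<inter> D"
    using U by (auto simp: \<U>_def)
  \<comment> \<open>The roles of \<open>a\<close> and \<open>b\<close> stay free because T0
    separation does not say which of the two points lies in the separating open set.\<close>
  have no_split: False if V: "openin X V" "a \<in> V" "b \<notin> V" "a \<in> U \<inter> D" "b \<in> U \<inter> D" for V a b
  proof -
    have "U \<inter> V \<in> \<U>"
      using U V by (auto simp: \<U>_def)
    moreover have "card (U \<inter> V \<inter> D) < card (U \<inter> D)"
      using V assms(2) by (intro psubset_card_mono) auto
    ultimately show False
      using min by fastforce
  qed
  have "q = p" if "q \<in> U \<inter> D" for q
  proof (rule ccontr)
    assume "q \<noteq> p"
    moreover have "p \<in> topspace X" "q \<in> topspace X"
      using p that assms(4) by auto
    ultimately obtain V where V: "openin X V" "p \<notin> V \<longleftrightarrow> q \<in> V"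
      using assms(1) unfolding t0_space_def by metis
    then show False
      using no_split p that by metis
  qed
  then have "U \<inter> D = {p}"
    using p by blast
  then show thesis
    using U that by (auto simp: \<U>_def)
qed

text \<open>The points \<open>x i\<close> may repeat; this is the coefficient of \<open>p\<close>
  once equal points are merged, and it is 0 at points that do not occur.\<close>

definition total_coeff :: "nat \<Rightarrow> (nat \<Rightarrow> real) \<Rightarrow> (nat \<Rightarrow> 'a) \<Rightarrow> 'a \<Rightarrow> real" where
  "total_coeff n r x p = (\<Sum>i<n. if x i = p then r i else 0)"

text \<open>Grouping the summands by their point. \<open>F\<close> may exceed the set of points that
  occur, so that two combinations can be compared over one common \<open>F\<close>.\<close>

lemma dirac_comb_eq_sum_total_coeff:
  assumes U: "openin X U" and r: "\<And>i. i < n \<Longrightarrow> 0 \<le> r i"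
    and F: "finite F" "x ` {..<n} \<subseteq> F"
  shows "dirac_comb X n r x U = ennreal (\<Sum>p\<in>F \<inter> U. total_coeff n r x p)"
proof -
  have "dirac_comb X n r x U = (\<Sum>i<n. ennreal (if x i \<in> U then r i else 0))"
    using U by (auto simp: dirac_comb_def dirac_def intro!: sum.cong)
  also have "\<dots> = ennreal (\<Sum>i<n. if x i \<in> U then r i else 0)"
    using r by (intro sum_ennreal) auto
  also have "(\<Sum>i<n. if x i \<in> U then r i else 0)
      = (\<Sum>i<n. \<Sum>p\<in>F \<inter> U. if x i = p then r i else 0)"
    using F by (intro sum.cong refl) (auto simp: sum.delta')
  also have "\<dots> = (\<Sum>p\<in>F \<inter> U. total_coeff n r x p)"
    unfolding total_coeff_def by (rule sum.swap)
  finally show ?thesis .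
qed

lemma total_coeff_nonneg: "(\<And>i. i < n \<Longrightarrow> 0 \<le> r i) \<Longrightarrow> 0 \<le> total_coeff n r x p"
  unfolding total_coeff_def by (intro sum_nonneg) auto

text \<open>If the coefficients differed somewhere, an open set would contain just one point where
  they differ, and the two valuations would disagree on that set.\<close>

lemma t0_space_total_coeff_unique:
  assumes "t0_space X"
    and r: "\<And>i. i < n \<Longrightarrow> 0 \<le> r i \<and> x i \<in> topspace X"
    and s: "\<And>i. i < m \<Longrightarrow> 0 \<le> s i \<and> y i \<in> topspace X"
    and eq: "dirac_comb X n r x = dirac_comb X m s y"
  shows "total_coeff n r x = total_coeff m s y"
proof -
  define F where "F = x ` {..<n} \<union> y ` {..<m}"
  define D where "D = {p \<in> F. total_coeff n r x p \<noteq> total_coeff m s y p}"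
  have "finite F" "F \<subseteq> topspace X"
    using r s by (auto simp: F_def)
  have sums: "(\<Sum>p\<in>F \<inter> U. total_coeff n r x p) = (\<Sum>p\<in>F \<inter> U. total_coeff m s y p)"
    if "openin X U" for U
  proof -
    have "ennreal (\<Sum>p\<in>F \<inter> U. total_coeff n r x p) = ennreal (\<Sum>p\<in>F \<inter> U. total_coeff m s y p)"
      using that r s eq \<open>finite F\<close>
        dirac_comb_eq_sum_total_coeff[of X U n r F x] dirac_comb_eq_sum_total_coeff[of X U m s F y]
      by (simp add: F_def)
    \<comment> \<open>\<open>ennreal\<close> sends all negative reals to 0, so cancelling it
      requires both sums to be nonnegative.\<close>
    then show ?thesis
      using r s by (simp add: sum_nonneg total_coeff_nonneg)
  qed
  have "D = {}"
  proof (rule ccontr)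
    assume "D \<noteq> {}"
    then obtain U p where U: "openin X U" and p: "U \<inter> D = {p}"
      using t0_space_finite_open_point[of X D] assms(1) \<open>finite F\<close> \<open>F \<subseteq> topspace X\<close>
      by (auto simp: D_def)
    \<comment> \<open>Outside \<open>D\<close> the differences vanish, so only the one at
      \<open>p\<close> survives.\<close>
    have "(\<Sum>q\<in>F \<inter> U. total_coeff n r x q - total_coeff m s y q)
        = (\<Sum>q\<in>{p}. total_coeff n r x q - total_coeff m s y q)"
      using \<open>finite F\<close> p by (intro sum.mono_neutral_right) (auto simp: D_def)
    then show False
      using sums[OF U] p by (auto simp: sum_subtractf D_def)
  qed
  moreover have "total_coeff n r x p = total_coeff m s y p" if "p \<notin> F" for p
    using that by (auto simp: total_coeff_def F_def intro!: trans[OF sum.neutral sum.neutral[symmetric]])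
  ultimately show ?thesis
    by (auto simp: D_def)
qed

context cone
begin

lemma finsum_lessThan_Suc:
  assumes "\<And>i. i < Suc n \<Longrightarrow> g i \<in> carrier C"
  shows "(\<Oplus>i\<in>{..<Suc n}. g i) = g n \<oplus> (\<Oplus>i\<in>{..<n}. g i)"
  using assms by (simp add: lessThan_Suc Pi_iff)

text \<open>Merges equal points inside the cone. The right-hand side sees the combination only
  through its total coefficients, which is what makes the barycentre independent of the
  representation.\<close>

lemma finsum_eq_finsum_total_coeff:
  assumes "\<And>i. i < n \<Longrightarrow> 0 \<le> r i \<and> x i \<in> carrier C"
    and F: "finite F" "x ` {..<n} \<subseteq> F" "F \<subseteq> carrier C"
  shows "(\<Oplus>i\<in>{..<n}. r i \<odot> x i) = (\<Oplus>p\<in>F. total_coeff n r x p \<odot> p)"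
  using assms(1) F(2)
proof (induction n)
  case 0
  have "(\<Oplus>p\<in>F. total_coeff 0 r x p \<odot> p) = (\<Oplus>p\<in>F. \<zero>)"
    using F by (intro finsum_cong') (auto simp: total_coeff_def smult_zero_left)
  then show ?case by simp
next
  case (Suc n)
  have nonneg: "0 \<le> total_coeff n r x p" for p
    using Suc.prems by (intro total_coeff_nonneg) auto
  have rn: "0 \<le> r n" "x n \<in> carrier C" "x n \<in> F"
    using Suc.prems by auto
  \<comment> \<open>The new summand becomes a sum over \<open>F\<close> concentrated at
    \<open>x n\<close>; \<open>smult_add_left\<close> then splits each coefficient, both parts being
    nonnegative.\<close>
  have "(\<Oplus>p\<in>F. total_coeff (Suc n) r x p \<odot> p)
      = (\<Oplus>p\<in>F. (if x n = p then r n \<odot> p else \<zero>) \<oplus> total_coeff n r x p \<odot> p)"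
    using F rn nonneg
    by (intro finsum_cong')
      (auto simp: total_coeff_def smult_add_left[symmetric] smult_closed add.commute subset_iff)
  also have "\<dots> = (\<Oplus>p\<in>F. if x n = p then r n \<odot> p else \<zero>) \<oplus> (\<Oplus>p\<in>F. total_coeff n r x p \<odot> p)"
    using F rn nonneg by (intro finsum_addf) (auto simp: smult_closed subset_iff)
  also have "(\<Oplus>p\<in>F. if x n = p then r n \<odot> p else \<zero>) = r n \<odot> x n"
    using F rn by (intro finsum_singleton) (auto simp: smult_closed subset_iff)
  also have "(\<Oplus>p\<in>F. total_coeff n r x p \<odot> p) = (\<Oplus>i\<in>{..<n}. r i \<odot> x i)"
    using Suc.prems by (intro Suc.IH[symmetric]) auto
  finally show ?case
    using Suc.prems by (simp add: finsum_lessThan_Suc smult_closed)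
qed

end

lemma (in cone_with_t0_topology) barycentre_dirac_comb:
  assumes r: "\<And>i. i < n \<Longrightarrow> 0 \<le> r i \<and> x i \<in> carrier C"
  shows "barycentre C T (dirac_comb T n r x) = (\<Oplus>i\<in>{..<n}. r i \<odot> x i)"
  unfolding barycentre_def
proof (rule the_equality)
  show "\<exists>n' r' x'. (\<forall>i<n'. 0 \<le> r' i \<and> x' i \<in> carrier C) \<and>
      dirac_comb T n r x = dirac_comb T n' r' x' \<and>
      (\<Oplus>i\<in>{..<n}. r i \<odot> x i) = (\<Oplus>i\<in>{..<n'}. r' i \<odot> x' i)"
    using r by blast
next
  fix z
  assume "\<exists>m s y. (\<forall>i<m. 0 \<le> s i \<and> y i \<in> carrier C) \<and>
      dirac_comb T n r x = dirac_comb T m s y \<and> z = (\<Oplus>i\<in>{..<m}. s i \<odot> y i)"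
  then obtain m s y where s: "\<And>i. i < m \<Longrightarrow> 0 \<le> s i \<and> y i \<in> carrier C"
    and eq: "dirac_comb T n r x = dirac_comb T m s y" and z: "z = (\<Oplus>i\<in>{..<m}. s i \<odot> y i)"
    by blast
  \<comment> \<open>A common index set turns both representations into sums over the same
    points.\<close>
  define F where "F = x ` {..<n} \<union> y ` {..<m}"
  have F: "finite F" "x ` {..<n} \<subseteq> F" "y ` {..<m} \<subseteq> F" "F \<subseteq> carrier C"
    using r s by (auto simp: F_def)
  have "total_coeff n r x = total_coeff m s y"
    using r s eq t0 by (intro t0_space_total_coeff_unique[of T]) (simp_all add: topspace_eq)
  then show "z = (\<Oplus>i\<in>{..<n}. r i \<odot> x i)"
    using finsum_eq_finsum_total_coeff[OF r F(1,2,4)] finsum_eq_finsum_total_coeff[OF s F(1,3,4)] z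
    by simp
qed

text \<open>Continuity makes the preimage of an open set open, so the valuation is not evaluated
  where it is \<open>undefined\<close>; on non-open \<open>V\<close> both sides are
  \<open>undefined\<close>.\<close>

lemma Vf_map_dirac_comb:
  assumes "continuous_map X Y f" "\<And>i. i < n \<Longrightarrow> x i \<in> topspace X"
  shows "Vf_map X Y f (dirac_comb X n r x) = dirac_comb Y n r (\<lambda>i. f (x i))"
proof
  fix V
  show "Vf_map X Y f (dirac_comb X n r x) V = dirac_comb Y n r (\<lambda>i. f (x i)) V"
  proof (cases "openin Y V")
    case True
    then have "openin X {x \<in> topspace X. f x \<in> V}"
      using assms(1) by (rule openin_continuous_map_preimage[rotated])
    with True assms(2) show ?thesis
      by (auto simp: Vf_map_def dirac_comb_def dirac_def intro!: sum.cong)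
  qed (simp add: Vf_map_def dirac_comb_def)
qed

lemma cone_linear_finsum:
  fixes n :: nat
  assumes "cone C" "cone D" "cone_linear C D f" and f: "f \<in> carrier C \<rightarrow> carrier D"
    and "\<And>i. i < n \<Longrightarrow> 0 \<le> r i \<and> x i \<in> carrier C"
  shows "f (\<Oplus>\<^bsub>C\<^esub>i\<in>{..<n}. r i \<odot>\<^bsub>C\<^esub> x i) = (\<Oplus>\<^bsub>D\<^esub>i\<in>{..<n}. r i \<odot>\<^bsub>D\<^esub> f (x i))"
proof -
  interpret C: cone C by fact
  interpret D: cone D by fact
  show ?thesis
    using assms(5)
  proof (induction n)
    case 0
    \<comment> \<open>Preservation of zero is not part of \<open>cone_linear\<close>; it comes from
      taking both scalars to be 0.\<close>
    have "f (0 \<odot>\<^bsub>C\<^esub> \<zero>\<^bsub>C\<^esub> \<oplus>\<^bsub>C\<^esub> 0 \<odot>\<^bsub>C\<^esub> \<zero>\<^bsub>C\<^esub>) = 0 \<odot>\<^bsub>D\<^esub> f \<zero>\<^bsub>C\<^esub> \<oplus>\<^bsub>D\<^esub> 0 \<odot>\<^bsub>D\<^esub> f \<zero>\<^bsub>C\<^esub>"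
      using assms(3) unfolding cone_linear_def by blast
    moreover have "f \<zero>\<^bsub>C\<^esub> \<in> carrier D"
      using f by blast
    ultimately show ?case
      by (simp add: C.smult_zero_left D.smult_zero_left)
  next
    case (Suc n)
    let ?z = "\<Oplus>\<^bsub>C\<^esub>i\<in>{..<n}. r i \<odot>\<^bsub>C\<^esub> x i"
    have z: "?z \<in> carrier C"
      using Suc.prems by (auto intro!: C.finsum_closed C.smult_closed)
    \<comment> \<open>The coefficient 1 makes the remaining sum the second argument of a binary
      combination.\<close>
    have "f (r n \<odot>\<^bsub>C\<^esub> x n \<oplus>\<^bsub>C\<^esub> 1 \<odot>\<^bsub>C\<^esub> ?z) = r n \<odot>\<^bsub>D\<^esub> f (x n) \<oplus>\<^bsub>D\<^esub> 1 \<odot>\<^bsub>D\<^esub> f ?z"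
      using assms(3) Suc.prems[of n] z unfolding cone_linear_def by simp
    moreover have "f ?z \<in> carrier D" "\<And>i. i < Suc n \<Longrightarrow> f (x i) \<in> carrier D"
      using f z Suc.prems by auto
    ultimately show ?case
      using Suc z
      by (simp add: C.finsum_lessThan_Suc D.finsum_lessThan_Suc C.smult_closed D.smult_closed
          C.smult_one D.smult_one)
  qed
qed

theorem theorem5p10:
  fixes X :: "(real, 'a, 'm) module_scheme" and Y :: "(real, 'b, 'n) module_scheme"
    and S :: "'a topology" and T :: "'b topology" and f :: "'a \<Rightarrow> 'b"
  assumes "weakly_locally_convex_topological_cone X S"
    and "weakly_locally_convex_topological_cone Y T"
    and "continuous_map S T f"
  shows "Vf_algebra_morphism S (barycentre X S) T (barycentre Y T) f \<longleftrightarrow> cone_linear X Y f"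
proof -
  interpret X: weakly_locally_convex_topological_cone X S by fact
  interpret Y: weakly_locally_convex_topological_cone Y T by fact
  have f: "f \<in> carrier X \<rightarrow> carrier Y"
    using continuous_map_funspace[OF assms(3)] by (simp add: X.topspace_eq Y.topspace_eq)
  have push: "barycentre Y T (Vf_map S T f (dirac_comb S n r x)) = (\<Oplus>\<^bsub>Y\<^esub>i\<in>{..<n}. r i \<odot>\<^bsub>Y\<^esub> f (x i))"
    if "\<And>i. i < n \<Longrightarrow> 0 \<le> r i \<and> x i \<in> carrier X" for n r x
    using that f
    by (subst Vf_map_dirac_comb[OF assms(3)], simp add: X.topspace_eq)
      (intro Y.barycentre_dirac_comb, auto)
  show ?thesis
  proof
    assume mor: "Vf_algebra_morphism S (barycentre X S) T (barycentre Y T) f"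
    show "cone_linear X Y f"
      unfolding cone_linear_def
    proof (intro allI ballI impI)
      fix r s :: real and x y
      assume rs: "0 \<le> r" "0 \<le> s" and xy: "x \<in> carrier X" "y \<in> carrier X"
      \<comment> \<open>Index 0 carries the second summand because
        \<open>finsum_lessThan_Suc\<close> puts the last index first, so the sum unfolds in the
        order of \<open>cone_linear\<close>.\<close>
      define c where "c = (\<lambda>i::nat. if i = 0 then s else r)"
      define z where "z = (\<lambda>i::nat. if i = 0 then y else x)"
      have cz: "0 \<le> c i \<and> z i \<in> carrier X" for i
        using rs xy by (simp add: c_def z_def)
      then have "dirac_comb S (Suc (Suc 0)) c z \<in> simple_valuations S"
        unfolding simple_valuations_def X.topspace_eq by blast
      then have "(\<Oplus>\<^bsub>Y\<^esub>i\<in>{..<Suc (Suc 0)}. c i \<odot>\<^bsub>Y\<^esub> f (z i))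
          = f (\<Oplus>\<^bsub>X\<^esub>i\<in>{..<Suc (Suc 0)}. c i \<odot>\<^bsub>X\<^esub> z i)"
        using mor cz push X.barycentre_dirac_comb
        unfolding Vf_algebra_morphism_def topspace_Vf by metis
      moreover have "f (z i) \<in> carrier Y" for i
        using cz f by blast
      ultimately have "c 1 \<odot>\<^bsub>Y\<^esub> f (z 1) \<oplus>\<^bsub>Y\<^esub> c 0 \<odot>\<^bsub>Y\<^esub> f (z 0) = f (c 1 \<odot>\<^bsub>X\<^esub> z 1 \<oplus>\<^bsub>X\<^esub> c 0 \<odot>\<^bsub>X\<^esub> z 0)"
        using cz by (simp add: X.finsum_lessThan_Suc Y.finsum_lessThan_Suc X.smult_closed Y.smult_closed)
      then show "f (r \<odot>\<^bsub>X\<^esub> x \<oplus>\<^bsub>X\<^esub> s \<odot>\<^bsub>X\<^esub> y) = r \<odot>\<^bsub>Y\<^esub> f x \<oplus>\<^bsub>Y\<^esub> s \<odot>\<^bsub>Y\<^esub> f y"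
        by (simp add: c_def z_def)
    qed
  next
    assume lin: "cone_linear X Y f"
    have "barycentre Y T (Vf_map S T f \<mu>) = f (barycentre X S \<mu>)"
      if simple: "\<mu> \<in> simple_valuations S" for \<mu>
    proof -
      obtain n r x where \<mu>: "\<mu> = dirac_comb S n r x"
        and "\<forall>i<n. 0 \<le> r i \<and> x i \<in> carrier X"
        using simple unfolding simple_valuations_def X.topspace_eq by blast
      then have r: "\<And>i. i < n \<Longrightarrow> 0 \<le> r i \<and> x i \<in> carrier X"
        by blast
      show ?thesis
        using cone_linear_finsum[OF X.cone_axioms Y.cone_axioms lin f, of n r x]
          push[of n r x] X.barycentre_dirac_comb[of n r x] r
        by (simp add: \<mu>)
    qed
    then show "Vf_algebra_morphism S (barycentre X S) T (barycentre Y T) f"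
      using assms(3) by (simp add: Vf_algebra_morphism_def topspace_Vf)
  qed
qed

end
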